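(* Let $\mathbb{K}$ be an algebraically closed field and let $u_1,u_2,u_3\in\mathbb{K}[t_1,t_2]$ be nonzero homogeneous polynomials of the same degree $d\geq 1$ without common factors. Let $\phi:\mathbb{P}^1\to\mathbb{P}^2$, $(t_1:t_2)\mapsto(u_1(\underline{t}):u_2(\underline{t}):u_3(\underline{t}))$, and let $\mathrm{C}:=\phi(\mathbb{P}^1)$. If $t_1X_2-t_2X_1\in\mathcal{K}_{1,1}$, then $\phi$ is a birational map (onto $\mathrm{C}$) and its inverse is given by $$\psi:\mathrm{C}\dashrightarrow\mathbb{P}^1,\qquad (X_1:X_2:X_3)\mapsto(X_1:X_2).$$
   Context: $\mathcal{K}$ denotes the kernel of the morphism of $\mathbb{K}[t_1,t_2]$-algebras $\mathbb{K}[t_1,t_2,X_1,X_2,X_3]\to\mathbb{K}[t_1,t_2][Z]$, $X_i\mapsto u_iZ$ ($Z$ a new variable). It is bigraded by total degrees in $\underline{t}=(t_1,t_2)$ and $\underline{X}=(X_1,X_2,X_3)$: a polynomial $P$ lies in $\mathcal{K}_{i,j}$ iff it is bihomogeneous of bidegree $(i,j)$ and $P(\underline{t},u_1(\underline{t}),u_2(\underline{t}),u_3(\underline{t}))=0$. In particular, the hypothesis says $t_1u_2=t_2u_1$. *)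

theory Defs
  imports
    "HOL-Analysis.Analysis"
    "HOL-Library.Poly_Mapping"
begin

section \<open>Polynomials in finitely many variables\<close>

text \<open>
  The variables are indexed by a finite type \<open>'n\<close>; monomials are finitely supported exponent
  functions. For the numeral types \<open>2\<close> and \<open>3\<close> the indices are written \<open>1, 2\<close> and \<open>1, 2, 3\<close>, as
  for the components of vectors in \<open>'a ^ 2\<close> and \<open>'a ^ 3\<close>.
\<close>

type_synonym ('a, 'n) mpoly = "('n \<Rightarrow>\<^sub>0 nat) \<Rightarrow>\<^sub>0 'a"

definition mp_const :: "'a::zero \<Rightarrow> ('a, 'n) mpoly"
  where "mp_const c = Poly_Mapping.single 0 c"

definition mp_var :: "'n \<Rightarrow> ('a::zero_neq_one, 'n) mpoly"
  where "mp_var i = Poly_Mapping.single (Poly_Mapping.single i 1) 1"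

definition mdeg :: "('n::finite \<Rightarrow>\<^sub>0 nat) \<Rightarrow> nat"
  where "mdeg m = (\<Sum>i\<in>UNIV. Poly_Mapping.lookup m i)"

text \<open>The zero polynomial is homogeneous of every degree.\<close>

definition homogeneous :: "nat \<Rightarrow> ('a::zero, 'n::finite) mpoly \<Rightarrow> bool"
  where "homogeneous d p \<longleftrightarrow> (\<forall>m\<in>Poly_Mapping.keys p. mdeg m = d)"

text \<open>
  For a ring homomorphism \<open>h\<close> on the coefficients, this is the unique ring homomorphism that
  extends \<open>h\<close> and sends the variable \<open>i\<close> to \<open>x i\<close>.
\<close>

definition mp_extend ::
    "('a::comm_ring_1 \<Rightarrow> 'b::comm_ring_1) \<Rightarrow> ('n::finite \<Rightarrow> 'b) \<Rightarrow> ('a, 'n) mpoly \<Rightarrow> 'b"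
  where "mp_extend h x p = (\<Sum>m\<in>Poly_Mapping.keys p.
    h (Poly_Mapping.lookup p m) * (\<Prod>i\<in>UNIV. x i ^ Poly_Mapping.lookup m i))"

definition mp_eval :: "('a::comm_ring_1, 'n::finite) mpoly \<Rightarrow> 'a ^ 'n \<Rightarrow> 'a"
  where "mp_eval p x = mp_extend (\<lambda>c. c) (\<lambda>i. x $ i) p"

definition mp_eval_vec :: "('a::comm_ring_1, 'n::finite) mpoly ^ 'm \<Rightarrow> 'a ^ 'n \<Rightarrow> 'a ^ 'm"
  where "mp_eval_vec F x = (\<chi> i. mp_eval (F $ i) x)"


section \<open>The bigraded kernel\<close>

text \<open>
  \<open>K[t\<^sub>1, t\<^sub>2, X\<^sub>1, X\<^sub>2, X\<^sub>3]\<close> is represented as the \<open>K[t\<^sub>1, t\<^sub>2]\<close>-algebra \<open>K[t\<^sub>1, t\<^sub>2][X\<^sub>1, X\<^sub>2, X\<^sub>3]\<close>,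
  and \<open>K[t\<^sub>1, t\<^sub>2][Z]\<close> by univariate polynomials over \<open>K[t\<^sub>1, t\<^sub>2]\<close>; thus \<open>[:0, u $ i:]\<close> is
  \<open>u\<^sub>i Z\<close>.
\<close>

definition param_hom ::
    "('a::comm_ring_1, 2) mpoly ^ 3 \<Rightarrow> (('a, 2) mpoly, 3) mpoly \<Rightarrow> ('a, 2) mpoly poly"
  where "param_hom u = mp_extend (\<lambda>c. [:c:]) (\<lambda>i. [:0, u $ i:])"

definition param_kernel :: "('a::comm_ring_1, 2) mpoly ^ 3 \<Rightarrow> (('a, 2) mpoly, 3) mpoly set"
  where "param_kernel u = {P. param_hom u P = 0}"

text \<open>Degree \<open>i\<close> in the \<open>t\<close>-variables (the coefficients), degree \<open>j\<close> in the \<open>X\<close>-variables.\<close>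

definition bihomogeneous :: "nat \<Rightarrow> nat \<Rightarrow> (('a::zero, 2) mpoly, 3) mpoly \<Rightarrow> bool"
  where "bihomogeneous i j P \<longleftrightarrow> homogeneous j P \<and>
    (\<forall>m\<in>Poly_Mapping.keys P. homogeneous i (Poly_Mapping.lookup P m))"

definition param_kernel_graded ::
    "('a::comm_ring_1, 2) mpoly ^ 3 \<Rightarrow> nat \<Rightarrow> nat \<Rightarrow> (('a, 2) mpoly, 3) mpoly set"
  where "param_kernel_graded u i j = {P \<in> param_kernel u. bihomogeneous i j P}"


section \<open>Projective space and its Zariski topology\<close>

definition proportional :: "'a::field ^ 'n \<Rightarrow> 'a ^ 'n \<Rightarrow> bool"
  where "proportional x y \<longleftrightarrow> x \<noteq> 0 \<and> y \<noteq> 0 \<and> (\<exists>c. c \<noteq> 0 \<and> y = c *s x)"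

lemma proportional_part_equivp: "part_equivp (proportional :: 'a::field ^ 'n \<Rightarrow> _)"
proof (rule part_equivpI)
  have "(1 :: 'a ^ 'n) \<noteq> 0"
    by (simp add: vec_eq_iff)
  moreover have "(1 :: 'a ^ 'n) = 1 *s 1 \<and> (1 :: 'a) \<noteq> 0"
    by simp
  ultimately show "\<exists>x :: 'a ^ 'n. proportional x x"
    unfolding proportional_def by blast
  show "symp (proportional :: 'a ^ 'n \<Rightarrow> _)"
  proof (rule sympI)
    fix x y :: "'a ^ 'n"
    assume "proportional x y"
    then obtain c where "x \<noteq> 0" "y \<noteq> 0" "c \<noteq> 0" "y = c *s x"
      unfolding proportional_def by blast
    then have "x = inverse c *s y" "inverse c \<noteq> 0"
      by (simp_all add: vector_smult_assoc)
    then show "proportional y x"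
      unfolding proportional_def using \<open>x \<noteq> 0\<close> \<open>y \<noteq> 0\<close> by blast
  qed
  show "transp (proportional :: 'a ^ 'n \<Rightarrow> _)"
  proof (rule transpI)
    fix x y z :: "'a ^ 'n"
    assume "proportional x y" "proportional y z"
    then obtain c e where "x \<noteq> 0" "z \<noteq> 0" "c \<noteq> 0" "e \<noteq> 0" "y = c *s x" "z = e *s y"
      unfolding proportional_def by blast
    then have "z = (e * c) *s x" "e * c \<noteq> 0"
      by (simp_all add: vector_smult_assoc)
    then show "proportional x z"
      unfolding proportional_def using \<open>x \<noteq> 0\<close> \<open>z \<noteq> 0\<close> by blast
  qed
qed

text \<open>
  The projective space of dimension \<open>CARD('n) - 1\<close>. For \<open>x \<noteq> 0\<close>, \<open>abs_proj x\<close> is the point with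
  homogeneous coordinates \<open>x\<close>; \<open>rep_proj P\<close> is some choice of homogeneous coordinates of \<open>P\<close>.
  Below, polynomials are evaluated at \<open>rep_proj P\<close>; for homogeneous polynomials (of equal degree,
  in the case of tuples) nothing depends on this choice, see the lemmas
  \<open>mp_eval_rep_eq_0_iff\<close>, \<open>abs_proj_in_form_dom_iff\<close> and \<open>form_map_abs_proj\<close>.
\<close>

quotient_type (overloaded) ('a, 'n) proj = "'a::field ^ 'n" / partial: proportional
  by (rule proportional_part_equivp)

definition zero_locus :: "('a::field, 'n::finite) mpoly set \<Rightarrow> ('a, 'n) proj set"
  where "zero_locus S = {P. \<forall>f\<in>S. mp_eval f (rep_proj P) = 0}"

definition zariski_closed :: "('a::field, 'n::finite) proj set \<Rightarrow> bool"
  where "zariski_closed A \<longleftrightarrow> (\<exists>S. (\<forall>f\<in>S. \<exists>d. homogeneous d f) \<and> A = zero_locus S)"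

definition zariski :: "('a::field, 'n::finite) proj topology"
  where "zariski = topology (\<lambda>U. zariski_closed (- U))"

lemma mdeg_add: "mdeg (m + n) = mdeg m + mdeg n"
  by (simp add: mdeg_def lookup_add sum.distrib)

lemma homogeneous_mult:
  assumes "homogeneous d p" "homogeneous e q"
  shows "homogeneous (d + e) (p * q)"
  unfolding homogeneous_def
proof
  fix m assume "m \<in> Poly_Mapping.keys (p * q)"
  then obtain a b where "a \<in> Poly_Mapping.keys p" "b \<in> Poly_Mapping.keys q" "m = a + b"
    using keys_mult[of p q] by blast
  then show "mdeg m = d + e"
    using assms by (simp add: homogeneous_def mdeg_add)
qed

lemma mp_eval_superset:
  assumes "finite A" "Poly_Mapping.keys p \<subseteq> A"
  shows "mp_eval p x =
    (\<Sum>m\<in>A. Poly_Mapping.lookup p m * (\<Prod>i\<in>UNIV. (x $ i) ^ Poly_Mapping.lookup m i))"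
  unfolding mp_eval_def mp_extend_def
  by (rule sum.mono_neutral_left) (use assms in \<open>auto simp: in_keys_iff\<close>)

lemma mp_eval_add: "mp_eval (p + q) x = mp_eval p x + mp_eval q x"
proof -
  have "Poly_Mapping.keys (p + q) \<subseteq> Poly_Mapping.keys p \<union> Poly_Mapping.keys q"
    by (rule Poly_Mapping.keys_add)
  then show ?thesis
    by (simp add: mp_eval_superset[of "Poly_Mapping.keys p \<union> Poly_Mapping.keys q"]
        lookup_add distrib_right sum.distrib)
qed

lemma mp_eval_single:
  "mp_eval (Poly_Mapping.single m c) x = c * (\<Prod>i\<in>UNIV. (x $ i) ^ Poly_Mapping.lookup m i)"
  by (subst mp_eval_superset[of "{m}"]) auto

lemma mp_eval_zero: "mp_eval 0 x = 0"
  by (simp add: mp_eval_def mp_extend_def)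

lemma mp_induct [case_names zero add_monomial]:
  assumes "Q 0"
    and "\<And>p m c. Q p \<Longrightarrow> Q (Poly_Mapping.single m c + p)"
  shows "Q (p :: ('a::comm_ring_1, 'n) mpoly)"
proof (induction p rule: update_induct)
  case const
  then show ?case by (rule assms(1))
next
  case (update p m c)
  have "Poly_Mapping.update m c p = Poly_Mapping.single m c + p"
    by (rule poly_mapping_eqI)
      (use update in \<open>auto simp: lookup_update lookup_add lookup_single when_def in_keys_iff\<close>)
  then show ?case
    using assms(2) update by simp
qed

lemma mp_eval_mult: "mp_eval (p * q) x = mp_eval p x * mp_eval q x"
proof (induction p rule: mp_induct)
  case (add_monomial p m c)
  have "mp_eval (Poly_Mapping.single m c * q) x = mp_eval (Poly_Mapping.single m c) x * mp_eval q x"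
  proof (induction q rule: mp_induct)
    case (add_monomial q n e)
    then show ?case
      by (simp add: distrib_left mp_eval_add mult_single mp_eval_single lookup_add power_add
          prod.distrib algebra_simps)
  qed (simp add: mp_eval_zero)
  with add_monomial show ?case
    by (simp add: distrib_right mp_eval_add)
qed (simp add: mp_eval_zero)

lemma mp_eval_scale:
  assumes "homogeneous d p"
  shows "mp_eval p (c *s x) = c ^ d * mp_eval p x"
  unfolding mp_eval_def mp_extend_def sum_distrib_left
proof (rule sum.cong[OF refl])
  fix m assume "m \<in> Poly_Mapping.keys p"
  then have "d = (\<Sum>i\<in>UNIV. Poly_Mapping.lookup m i)"
    using assms by (simp add: homogeneous_def mdeg_def)
  then have "(\<Prod>i\<in>UNIV. c ^ Poly_Mapping.lookup m i) = c ^ d"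
    by (simp add: power_sum)
  then show "Poly_Mapping.lookup p m * (\<Prod>i\<in>UNIV. (c *s x) $ i ^ Poly_Mapping.lookup m i)
      = c ^ d * (Poly_Mapping.lookup p m * (\<Prod>i\<in>UNIV. x $ i ^ Poly_Mapping.lookup m i))"
    by (simp add: power_mult_distrib prod.distrib)
qed

lemma abs_proj_eq_iff:
  assumes "x \<noteq> 0" "y \<noteq> 0"
  shows "abs_proj x = abs_proj y \<longleftrightarrow> (\<exists>c. c \<noteq> 0 \<and> y = c *s x)"
proof -
  have "proportional x x" "proportional y y"
    unfolding proportional_def using assms by (auto intro!: exI[of _ 1])
  then have "abs_proj x = abs_proj y \<longleftrightarrow> proportional x y"
    using Quotient3_rel[OF Quotient3_proj, of x y] by simp
  then show ?thesis
    using assms by (simp add: proportional_def)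
qed

lemma rep_proj_nonzero: "rep_proj P \<noteq> 0"
  using Quotient3_rep_reflp[OF Quotient3_proj, of P] by (simp add: proportional_def)

lemma abs_rep_proj: "abs_proj (rep_proj P) = P"
  by (rule Quotient3_abs_rep[OF Quotient3_proj])

lemma rep_abs_proj:
  assumes "x \<noteq> 0"
  obtains c where "c \<noteq> 0" "rep_proj (abs_proj x) = c *s x"
  using abs_proj_eq_iff[OF assms rep_proj_nonzero[of "abs_proj x"]] by (auto simp: abs_rep_proj)

lemma mp_eval_rep_eq_0_iff:
  assumes "homogeneous d p" "x \<noteq> 0"
  shows "mp_eval p (rep_proj (abs_proj x)) = 0 \<longleftrightarrow> mp_eval p x = 0"
proof -
  obtain c where "c \<noteq> 0" "rep_proj (abs_proj x) = c *s x"
    using rep_abs_proj[OF assms(2)] .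
  then show ?thesis
    by (simp add: mp_eval_scale[OF assms(1)])
qed

lemma istopology_zariski:
  "istopology (\<lambda>U :: ('a::field, 'n::finite) proj set. zariski_closed (- U))"
  unfolding istopology_def
proof (intro conjI allI impI)
  fix U V :: "('a, 'n) proj set"
  assume U: "zariski_closed (- U)" and V: "zariski_closed (- V)"
  obtain S where S: "\<forall>f\<in>S. \<exists>d. homogeneous d f" "- U = zero_locus S"
    using U unfolding zariski_closed_def by (elim exE conjE)
  obtain T where T: "\<forall>f\<in>T. \<exists>d. homogeneous d f" "- V = zero_locus T"
    using V unfolding zariski_closed_def by (elim exE conjE)
  define R where "R = {f * g |f g. f \<in> S \<and> g \<in> T}"
  have "\<forall>f\<in>R. \<exists>d. homogeneous d f"
    unfolding R_def using S(1) T(1) homogeneous_mult by blast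
  moreover have "- (U \<inter> V) = zero_locus R"
  proof -
    have "P \<in> zero_locus R \<longleftrightarrow> P \<in> zero_locus S \<or> P \<in> zero_locus T" for P
    proof -
      have "P \<in> zero_locus R \<longleftrightarrow>
          (\<forall>f\<in>S. \<forall>g\<in>T. mp_eval (f * g) (rep_proj P) = 0)"
        unfolding zero_locus_def R_def by blast
      then have "P \<in> zero_locus R \<longleftrightarrow>
          (\<forall>f\<in>S. \<forall>g\<in>T. mp_eval f (rep_proj P) = 0 \<or> mp_eval g (rep_proj P) = 0)"
        by (simp only: mp_eval_mult mult_eq_0_iff)
      then show ?thesis
        unfolding zero_locus_def mem_Collect_eq by blast
    qed
    then show ?thesis
      unfolding Compl_Int S(2) T(2) by blast
  qed
  ultimately show "zariski_closed (- (U \<inter> V))"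
    unfolding zariski_closed_def by blast
next
  fix \<K> :: "('a, 'n) proj set set"
  assume "\<forall>K\<in>\<K>. zariski_closed (- K)"
  then have "\<forall>K\<in>\<K>. \<exists>S. (\<forall>f\<in>S. \<exists>d. homogeneous d f) \<and> - K = zero_locus S"
    by (simp only: zariski_closed_def)
  from bchoice[OF this] obtain S where S: "\<forall>K\<in>\<K>. (\<forall>f\<in>S K. \<exists>d. homogeneous d f) \<and> - K = zero_locus (S K)"
    by (elim exE)
  have "- \<Union>\<K> = zero_locus (\<Union>K\<in>\<K>. S K)"
  proof -
    have "zero_locus (\<Union>K\<in>\<K>. S K) = (\<Inter>K\<in>\<K>. zero_locus (S K))"
      unfolding zero_locus_def by blast
    also have "\<dots> = (\<Inter>K\<in>\<K>. - K)"
      using S by (intro INF_cong) simp_all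
    also have "\<dots> = - \<Union>\<K>"
      by blast
    finally show ?thesis ..
  qed
  moreover have "\<forall>f\<in>(\<Union>K\<in>\<K>. S K). \<exists>d. homogeneous d f"
    using S by blast
  ultimately show "zariski_closed (- \<Union>\<K>)"
    unfolding zariski_closed_def by blast
qed

lemma openin_zariski: "openin zariski U \<longleftrightarrow> zariski_closed (- U)"
  unfolding zariski_def by (simp add: topology_inverse'[OF istopology_zariski])

lemma topspace_zariski: "topspace zariski = (UNIV :: ('a::field, 'n::finite) proj set)"
proof -
  have "zero_locus {1} = ({} :: ('a, 'n) proj set)"
    unfolding zero_locus_def by (simp add: mp_eval_single[of 0 1, simplified])
  moreover have "homogeneous 0 (1 :: ('a, 'n) mpoly)"
    by (simp add: homogeneous_def mdeg_def)
  ultimately have "zariski_closed ({} :: ('a, 'n) proj set)"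
    unfolding zariski_closed_def by (intro exI[of _ "{1}"]) auto
  then have "openin zariski (UNIV :: ('a, 'n) proj set)"
    by (simp add: openin_zariski)
  then show ?thesis
    by (metis openin_subset top.extremum_uniqueI)
qed

lemma closedin_zariski: "closedin zariski A \<longleftrightarrow> zariski_closed A"
  by (simp add: closedin_def topspace_zariski openin_zariski Compl_eq_Diff_UNIV[symmetric])


section \<open>Varieties, regular maps and rational maps\<close>

definition irreducible_space :: "'p topology \<Rightarrow> bool"
  where "irreducible_space T \<longleftrightarrow> topspace T \<noteq> {} \<and>
    (\<forall>A B. closedin T A \<and> closedin T B \<and> A \<union> B = topspace T
      \<longrightarrow> A = topspace T \<or> B = topspace T)"

definition projective_variety :: "('a::field, 'n::finite) proj set \<Rightarrow> bool"
  where "projective_variety X \<longleftrightarrow>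
    closedin zariski X \<and> irreducible_space (subtopology zariski X)"

text \<open>
  The map \<open>P \<mapsto> (F\<^sub>1(P) : \<dots> : F\<^sub>m(P))\<close> given by homogeneous polynomials of the same degree, and the
  set of points at which these have no common zero. Outside this set \<open>form_map\<close> is meaningless.
\<close>

definition form_dom :: "('a::field, 'n::finite) mpoly ^ 'm \<Rightarrow> ('a, 'n) proj set"
  where "form_dom F = {P. mp_eval_vec F (rep_proj P) \<noteq> 0}"

definition form_map ::
    "('a::field, 'n::finite) mpoly ^ 'm \<Rightarrow> ('a, 'n) proj \<Rightarrow> ('a, 'm) proj"
  where "form_map F P = abs_proj (mp_eval_vec F (rep_proj P))"

lemma mp_eval_vec_scale:
  assumes "\<forall>i. homogeneous d (F $ i)"
  shows "mp_eval_vec F (c *s x) = c ^ d *s mp_eval_vec F x"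
  using assms by (simp add: mp_eval_vec_def vec_eq_iff mp_eval_scale)

lemma abs_proj_in_form_dom_iff:
  assumes "\<forall>i. homogeneous d (F $ i)" "x \<noteq> 0"
  shows "abs_proj x \<in> form_dom F \<longleftrightarrow> mp_eval_vec F x \<noteq> 0"
proof -
  obtain c where "c \<noteq> 0" "rep_proj (abs_proj x) = c *s x"
    using rep_abs_proj[OF assms(2)] .
  then show ?thesis
    by (simp add: form_dom_def mp_eval_vec_scale[OF assms(1)])
qed

lemma form_map_abs_proj:
  assumes "\<forall>i. homogeneous d (F $ i)" "x \<noteq> 0" "mp_eval_vec F x \<noteq> 0"
  shows "form_map F (abs_proj x) = abs_proj (mp_eval_vec F x)"
proof -
  obtain c where c: "c \<noteq> 0" "rep_proj (abs_proj x) = c *s x"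
    using rep_abs_proj[OF assms(2)] .
  then have "abs_proj (mp_eval_vec F x) = abs_proj (c ^ d *s mp_eval_vec F x)"
    using assms(3) by (subst abs_proj_eq_iff) (auto intro!: exI[of _ "c ^ d"])
  then show ?thesis
    by (simp add: form_map_def c(2) mp_eval_vec_scale[OF assms(1)])
qed

text \<open>
  Regular maps from a subset of projective space to a projective space: locally given by
  homogeneous polynomials of the same degree without common zero.
\<close>

definition regular_on ::
    "('a::field, 'n::finite) proj set \<Rightarrow> (('a, 'n) proj \<Rightarrow> ('a, 'm::finite) proj) \<Rightarrow> bool"
  where "regular_on X f \<longleftrightarrow> (\<forall>P\<in>X. \<exists>U F d.
    openin (subtopology zariski X) U \<and> P \<in> U \<and> (\<forall>i. homogeneous d (F $ i)) \<and>
    U \<subseteq> form_dom F \<and> (\<forall>Q\<in>U. f Q = form_map F Q))"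

text \<open>
  A rational map \<open>X \<dashrightarrow> Y\<close> is represented by a pair \<open>(U, f)\<close> of a nonempty open subset \<open>U\<close> of \<open>X\<close>
  and a map \<open>f\<close> that is regular on \<open>U\<close> with values in \<open>Y\<close>; the values of \<open>f\<close> outside \<open>U\<close> are
  irrelevant. Two representatives define the same rational map iff they agree on the
  intersection of their domains.
\<close>

type_synonym ('a, 'n, 'm) rat_rep =
  "('a, 'n) proj set \<times> (('a, 'n) proj \<Rightarrow> ('a, 'm) proj)"

definition rational_map ::
    "('a::field, 'n::finite) proj set \<Rightarrow> ('a, 'm::finite) proj set \<Rightarrow> ('a, 'n, 'm) rat_rep \<Rightarrow> bool"
  where "rational_map X Y r \<longleftrightarrow> projective_variety X \<and> projective_variety Y \<and>
    openin (subtopology zariski X) (fst r) \<and> fst r \<noteq> {} \<and>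
    regular_on (fst r) (snd r) \<and> snd r ` fst r \<subseteq> Y"

definition rational_eq :: "('a::field, 'n, 'm) rat_rep \<Rightarrow> ('a, 'n, 'm) rat_rep \<Rightarrow> bool"
  where "rational_eq r s \<longleftrightarrow> (\<forall>P \<in> fst r \<inter> fst s. snd r P = snd s P)"

text \<open>
  The composite \<open>s \<circ> r\<close>; it is a rational map only if its domain is nonempty.
\<close>

definition rational_comp ::
    "('a::field, 'm, 'k) rat_rep \<Rightarrow> ('a, 'n, 'm) rat_rep \<Rightarrow> ('a, 'n, 'k) rat_rep"
  where "rational_comp s r = ({P \<in> fst r. snd r P \<in> fst s}, snd s \<circ> snd r)"

definition rational_id :: "('a::field, 'n) proj set \<Rightarrow> ('a, 'n, 'n) rat_rep"
  where "rational_id X = (X, \<lambda>P. P)"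

definition rational_inverse ::
    "('a::field, 'n::finite) proj set \<Rightarrow> ('a, 'm::finite) proj set \<Rightarrow>
      ('a, 'n, 'm) rat_rep \<Rightarrow> ('a, 'm, 'n) rat_rep \<Rightarrow> bool"
  where "rational_inverse X Y r s \<longleftrightarrow>
    rational_map X Y r \<and> rational_map Y X s \<and>
    rational_map X X (rational_comp s r) \<and> rational_eq (rational_comp s r) (rational_id X) \<and>
    rational_map Y Y (rational_comp r s) \<and> rational_eq (rational_comp r s) (rational_id Y)"

definition birational_map ::
    "('a::field, 'n::finite) proj set \<Rightarrow> ('a, 'm::finite) proj set \<Rightarrow> ('a, 'n, 'm) rat_rep \<Rightarrow> bool"
  where "birational_map X Y r \<longleftrightarrow> (\<exists>s. rational_inverse X Y r s)"

text \<open>The rational map on \<open>X\<close> given by homogeneous polynomials of the same degree.\<close>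

definition form_rational ::
    "('a::field, 'n::finite) proj set \<Rightarrow> ('a, 'n) mpoly ^ 'm \<Rightarrow> ('a, 'n, 'm) rat_rep"
  where "form_rational X F = (X \<inter> form_dom F, form_map F)"

end

theory Submission
  imports Defs
begin

text \<open>
  The hypothesis means \<open>t\<^sub>1 u\<^sub>2 = t\<^sub>2 u\<^sub>1\<close>, so \<open>u\<^sub>1 = t\<^sub>1 h\<close> and \<open>u\<^sub>2 = t\<^sub>2 h\<close> for a form \<open>h\<close> of degree
  \<open>d - 1\<close>. Wherever \<open>h(t) \<noteq> 0\<close>, the first two coordinates of \<open>\<phi>(t)\<close> are proportional to \<open>t\<close>, and
  projecting to them inverts \<open>\<phi>\<close>. That \<open>C\<close> is closed needs no elimination theory: it is the zero
  locus of \<open>X\<^sub>3 h(X\<^sub>1, X\<^sub>2) - u\<^sub>3(X\<^sub>1, X\<^sub>2)\<close>. It is irreducible as the continuous image of the line.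
\<close>


section \<open>Evaluation and substitution\<close>

text \<open>Applied with \<open>k\<close> an evaluation, at a vector or at a scalar, this computes
  values of substituted polynomials and of restrictions to lines.\<close>

lemma hom_mp_extend:
  fixes k :: "'b::comm_ring_1 \<Rightarrow> 'c::comm_ring_1" and x :: "'n::finite \<Rightarrow> 'b"
  assumes "k 0 = 0" "k 1 = 1"
    and "\<And>a b. k (a + b) = k a + k b" "\<And>a b. k (a * b) = k a * k b"
  shows "k (mp_extend h x p) = mp_extend (\<lambda>c. k (h c)) (\<lambda>i. k (x i)) p"
proof -
  have sum: "k (sum f A) = (\<Sum>a\<in>A. k (f a))" if "finite A" for f :: "('n \<Rightarrow>\<^sub>0 nat) \<Rightarrow> 'b" and A
    using that by (induction A rule: finite_induct) (auto simp: assms)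
  have prod: "k (prod f A) = (\<Prod>a\<in>A. k (f a))" if "finite A" for f :: "'n \<Rightarrow> 'b" and A
    using that by (induction A rule: finite_induct) (auto simp: assms)
  have power: "k (a ^ n) = k a ^ n" for a n
    by (induction n) (auto simp: assms)
  show ?thesis
    unfolding mp_extend_def by (simp add: sum prod power assms(4))
qed

lemma mp_eval_minus: "mp_eval (p - q) x = mp_eval p x - mp_eval q x"
proof -
  have "mp_eval p x = mp_eval (p - q) x + mp_eval q x"
    using mp_eval_add[of "p - q" q x] by simp
  then show ?thesis
    by simp
qed

lemma mp_eval_one: "mp_eval 1 x = 1"
  using mp_eval_single[of 0 1 x] by simp

lemma prod_power_single:
  fixes x :: "'n::finite \<Rightarrow> 'a::comm_semiring_1"
  shows "(\<Prod>j\<in>UNIV. x j ^ Poly_Mapping.lookup (Poly_Mapping.single i k) j) = x i ^ k"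
proof -
  have "(\<Prod>j\<in>UNIV. x j ^ Poly_Mapping.lookup (Poly_Mapping.single i k) j)
      = (\<Prod>j\<in>UNIV. if j = i then x j ^ k else 1)"
    by (intro prod.cong) (auto simp: lookup_single when_def)
  then show ?thesis
    by simp
qed

lemma mp_eval_const: "mp_eval (mp_const c) x = c"
  by (simp add: mp_const_def mp_eval_single)

lemma mp_eval_var: "mp_eval (mp_var i) x = x $ i"
  by (simp add: mp_var_def mp_eval_single prod_power_single)

section \<open>Degrees of sums, products and powers\<close>

lemma homogeneous_var: "homogeneous 1 (mp_var i)"
  by (auto simp: homogeneous_def mp_var_def mdeg_def lookup_single when_def)

lemma homogeneous_const: "homogeneous 0 (mp_const c)"
  by (auto simp: homogeneous_def mp_const_def mdeg_def split: if_splits)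

lemma homogeneous_add:
  assumes "homogeneous d p" "homogeneous d q"
  shows "homogeneous d (p + q)"
  using assms Poly_Mapping.keys_add[of p q] by (auto simp: homogeneous_def)

lemma homogeneous_minus:
  fixes p q :: "('a::ab_group_add, 'n::finite) mpoly"
  assumes "homogeneous d p" "homogeneous d q"
  shows "homogeneous d (p - q)"
  using assms keys_diff[of p q] by (auto simp: homogeneous_def)

lemma homogeneous_sum:
  assumes "\<And>a. a \<in> A \<Longrightarrow> homogeneous d (f a)"
  shows "homogeneous d (\<Sum>a\<in>A. f a)"
  using assms
proof (induction A rule: infinite_finite_induct)
  case (insert a A)
  then show ?case
    by (simp add: homogeneous_add)
qed (simp_all add: homogeneous_def)

lemma homogeneous_one: "homogeneous 0 1"
  by (simp add: homogeneous_def mdeg_def)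

lemma homogeneous_power:
  assumes "homogeneous d p"
  shows "homogeneous (k * d) (p ^ k)"
  by (induction k) (auto intro: homogeneous_mult homogeneous_one assms)

lemma homogeneous_prod:
  assumes "\<And>a. a \<in> A \<Longrightarrow> homogeneous (e a) (f a)" "finite A"
  shows "homogeneous (\<Sum>a\<in>A. e a) (\<Prod>a\<in>A. f a)"
  using assms(2,1)
  by (induction A rule: finite_induct) (auto intro: homogeneous_mult homogeneous_one)

text \<open>The pullback of polynomials along \<open>F\<close>; through it, preimages of zero loci
  under \<open>form_map F\<close> become zero loci.\<close>

definition mp_subst ::
    "('a::comm_ring_1, 'm::finite) mpoly ^ 'n \<Rightarrow> ('a, 'n::finite) mpoly \<Rightarrow> ('a, 'm) mpoly"
  where "mp_subst F p = mp_extend mp_const (\<lambda>i. F $ i) p"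

lemma mp_eval_subst: "mp_eval (mp_subst F p) x = mp_eval p (mp_eval_vec F x)"
  unfolding mp_subst_def
  by (subst hom_mp_extend[where k = "\<lambda>q. mp_eval q x"])
    (simp_all add: mp_eval_zero mp_eval_one mp_eval_add mp_eval_mult mp_eval_const mp_eval_vec_def
      mp_eval_def[of p])

text \<open>A monomial of degree \<open>e\<close> becomes a constant times a product of
  \<open>e\<close> forms of degree \<open>d\<close>.\<close>

lemma homogeneous_subst:
  assumes "homogeneous e p" "\<forall>i. homogeneous d (F $ i)"
  shows "homogeneous (e * d) (mp_subst F p)"
  unfolding mp_subst_def mp_extend_def
proof (rule homogeneous_sum)
  fix m assume "m \<in> Poly_Mapping.keys p"
  then have e: "e = (\<Sum>i\<in>UNIV. Poly_Mapping.lookup m i)"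
    using assms(1) by (simp add: homogeneous_def mdeg_def)
  have "homogeneous (0 + (\<Sum>i\<in>UNIV. Poly_Mapping.lookup m i * d))
    (mp_const (Poly_Mapping.lookup p m) * (\<Prod>i\<in>UNIV. F $ i ^ Poly_Mapping.lookup m i))"
    using assms(2)
    by (intro homogeneous_mult homogeneous_const homogeneous_prod homogeneous_power) auto
  then show "homogeneous (e * d)
    (mp_const (Poly_Mapping.lookup p m) * (\<Prod>i\<in>UNIV. F $ i ^ Poly_Mapping.lookup m i))"
    by (simp add: e sum_distrib_right)
qed

text \<open>Reduces questions about several variables to roots of one univariate polynomial; the
  witness substitutes the linear polynomial \<open>[:x $ i, y $ i:]\<close> for variable
  \<open>i\<close>.\<close>

lemma mp_eval_line:
  obtains q where "\<And>t. poly q t = mp_eval p (x + t *s y)"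
proof
  fix t
  show "poly (mp_extend (\<lambda>c. [:c:]) (\<lambda>i. [:x $ i, y $ i:]) p) t = mp_eval p (x + t *s y)"
    by (subst hom_mp_extend[where k = "\<lambda>q. poly q t"]) (simp_all add: mp_eval_def)
qed


section \<open>Binary forms\<close>

lemma UNIV_prod_2: "(\<Prod>i\<in>(UNIV :: 2 set). f i) = f 1 * f 2"
  by (simp add: UNIV_2)

text \<open>Multiplication by a variable shifts exponents injectively, so nothing cancels and each
  monomial of \<open>p\<close> reappears with degree one higher.\<close>

lemma homogeneous_var_mult_cancel:
  assumes "homogeneous d (mp_var i * p)" "d \<ge> 1"
  shows "homogeneous (d - 1) (p :: ('a::comm_ring_1, 'n::finite) mpoly)"
  unfolding homogeneous_def
proof
  fix m assume m: "m \<in> Poly_Mapping.keys p"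
  define e :: "'n \<Rightarrow>\<^sub>0 nat" where "e = Poly_Mapping.single i 1"
  have "Poly_Mapping.lookup (Poly_Mapping.single e 1 * p) (e + m) = Poly_Mapping.lookup p m"
  proof (induction p rule: mp_induct)
    case (add_monomial p n c)
    then show ?case
      by (auto simp: distrib_left mult_single lookup_add lookup_single when_def)
  qed simp
  then have "e + m \<in> Poly_Mapping.keys (mp_var i * p)"
    using m by (simp add: in_keys_iff mp_var_def e_def)
  then have "mdeg (e + m) = d"
    using assms(1) by (simp add: homogeneous_def)
  moreover have "mdeg e = 1"
    by (simp add: e_def mdeg_def lookup_single when_def)
  ultimately show "mdeg m = d - 1"
    by (simp add: mdeg_add)
qed

lemma mp_monomial:
  fixes c :: "'a::comm_ring_1" and m :: "'n::finite \<Rightarrow>\<^sub>0 nat"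
  shows "Poly_Mapping.single m c = mp_const c * (\<Prod>i\<in>UNIV. mp_var i ^ Poly_Mapping.lookup m i)"
proof -
  have var_power: "mp_var i ^ k = Poly_Mapping.single (Poly_Mapping.single i k) (1 :: 'a)"
    for i :: 'n and k
    by (induction k) (simp_all add: mp_var_def mult_single single_add[symmetric])
  have "(\<Prod>i\<in>A. mp_var i ^ Poly_Mapping.lookup m i)
      = Poly_Mapping.single (\<Sum>i\<in>A. Poly_Mapping.single i (Poly_Mapping.lookup m i)) (1 :: 'a)"
    for A :: "'n set"
    by (induction A rule: infinite_finite_induct) (simp_all add: var_power mult_single)
  moreover have "(\<Sum>i\<in>UNIV. Poly_Mapping.single i (Poly_Mapping.lookup m i)) = m"
    by (rule poly_mapping_eqI) (simp add: lookup_sum lookup_single when_def)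
  ultimately show ?thesis
    by (simp add: mp_const_def mult_single)
qed

lemma mp_expand:
  fixes p :: "('a::comm_ring_1, 'n::finite) mpoly"
  shows "p = (\<Sum>m\<in>Poly_Mapping.keys p. mp_const (Poly_Mapping.lookup p m) *
    (\<Prod>i\<in>UNIV. mp_var i ^ Poly_Mapping.lookup m i))"
  unfolding mp_monomial[symmetric]
  by (rule poly_mapping_eqI) (auto simp: lookup_sum lookup_single when_def in_keys_iff)

lemma mp_const_mult: "mp_const (a * b) = mp_const a * mp_const b"
  by (simp add: mp_const_def mult_single)

lemma mp_const_power: "mp_const (a ^ k) = mp_const a ^ k"
proof (induction k)
  case 0
  then show ?case
    by (simp add: mp_const_def)
qed (simp add: mp_const_mult)

lemma mp_const_sum: "mp_const (\<Sum>a\<in>A. f a) = (\<Sum>a\<in>A. mp_const (f a))"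
  by (induction A rule: infinite_finite_induct) (simp_all add: mp_const_def single_add)

text \<open>Modulo \<open>t\<^sub>i - c t\<^sub>j\<close>, a form \<open>p\<close> of degree \<open>d\<close> is congruent to \<open>p(x) t\<^sub>j\<^sup>d\<close>,
  where \<open>x\<^sub>i = c\<close> and \<open>x\<^sub>j = 1\<close>.\<close>

lemma linear_form_dvd:
  fixes p :: "('a::field, 2) mpoly"
  assumes "homogeneous d p" "mp_eval p x = 0" "x $ j \<noteq> 0" "UNIV = {i, j}" "i \<noteq> j"
  shows "mp_var i - mp_const (x $ i / x $ j) * mp_var j dvd p"
proof -
  define c where "c = x $ i / x $ j"
  define l where "l = mp_var i - mp_const c * mp_var j"
  have prod: "(\<Prod>i\<in>UNIV. f i) = f i * f j" for f :: "2 \<Rightarrow> 'b::comm_ring_1"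
    using assms(5) by (simp add: assms(4))
  \<comment> \<open>By homogeneity, vanishing at \<open>x\<close> can be tested at the rescaled
    vector, whose entry at \<open>j\<close> is 1 and whose entry at \<open>i\<close> is
    \<open>c\<close>.\<close>
  have "x = (x $ j) *s (\<chi> k. if k = j then 1 else c)"
    using assms(3) unfolding vec_eq_iff
  proof (intro allI)
    fix k
    have "k = i \<or> k = j"
      using assms(4) by blast
    then show "x $ k = (x $ j *s (\<chi> k. if k = j then 1 else c)) $ k"
      using assms(3,5) by (auto simp: c_def)
  qed
  then have "mp_eval p (\<chi> k. if k = j then 1 else c) = 0"
    using assms(2,3) mp_eval_scale[OF assms(1), of "x $ j"] by (metis mult_eq_0_iff power_not_zero)
  then have zero:
    "(\<Sum>m\<in>Poly_Mapping.keys p. Poly_Mapping.lookup p m * c ^ Poly_Mapping.lookup m i) = 0"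
    using assms(5) by (simp add: mp_eval_def mp_extend_def prod)
  \<comment> \<open>The constant 0 is then rewritten by \<open>zero\<close> as the value of
    \<open>p\<close> at the rescaled vector, so that the difference splits over the monomials of
    \<open>p\<close>.\<close>
  have "p = p - mp_const 0 * mp_var j ^ d"
    by (simp add: mp_const_def)
  also have "\<dots> = (\<Sum>m\<in>Poly_Mapping.keys p. mp_const (Poly_Mapping.lookup p m) *
    (mp_var i ^ Poly_Mapping.lookup m i * mp_var j ^ Poly_Mapping.lookup m j
      - mp_const c ^ Poly_Mapping.lookup m i * mp_var j ^ d))"
    unfolding zero[symmetric] mp_const_sum sum_distrib_right right_diff_distrib sum_subtractf
    using mp_expand[of p] by (simp add: prod mp_const_mult mp_const_power mult.assoc)
  also have "l dvd \<dots>"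
  proof (intro dvd_sum dvd_mult)
    fix m assume "m \<in> Poly_Mapping.keys p"
    then have "d = (\<Sum>k\<in>UNIV. Poly_Mapping.lookup m k)"
      using assms(1) by (simp add: homogeneous_def mdeg_def)
    then have d: "d = Poly_Mapping.lookup m i + Poly_Mapping.lookup m j"
      using assms(5) by (simp add: assms(4))
    \<comment> \<open>An instance of \<open>a - b\<close> dividing \<open>a ^ k - b ^ k\<close>; the
      remaining power of \<open>mp_var j\<close> then restores degree \<open>d\<close>.\<close>
    have "l dvd mp_var i ^ Poly_Mapping.lookup m i - (mp_const c * mp_var j) ^ Poly_Mapping.lookup m i"
      unfolding l_def by (subst power_diff_sumr2) (rule dvd_triv_left)
    then have "l dvd (mp_var i ^ Poly_Mapping.lookup m i - (mp_const c * mp_var j) ^ Poly_Mapping.lookup m i)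
        * mp_var j ^ Poly_Mapping.lookup m j"
      by (rule dvd_mult2)
    then show "l dvd mp_var i ^ Poly_Mapping.lookup m i * mp_var j ^ Poly_Mapping.lookup m j
      - mp_const c ^ Poly_Mapping.lookup m i * mp_var j ^ d"
      by (simp add: d power_add algebra_simps power_mult_distrib)
  qed
  finally show ?thesis
    by (simp add: l_def c_def)
qed

text \<open>By \<open>linear_form_dvd\<close>, a common zero yields a common linear factor. That
  factor vanishes at \<open>x\<close>, so it cannot divide 1.\<close>

lemma coprime_forms_no_common_zero:
  fixes u :: "('a::field, 2) mpoly ^ 'm"
  assumes "\<forall>i. homogeneous d (u $ i)" "\<forall>g. (\<forall>i. g dvd u $ i) \<longrightarrow> g dvd 1" "x \<noteq> 0"
  shows "mp_eval_vec u x \<noteq> 0"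
proof
  assume "mp_eval_vec u x = 0"
  then have zero: "mp_eval (u $ i) x = 0" for i
    by (simp add: mp_eval_vec_def vec_eq_iff)
  obtain i j :: 2 where ij: "UNIV = {i, j}" "i \<noteq> j" "x $ j \<noteq> 0"
  proof (cases "x $ 2 = 0")
    case True
    then have "x $ 1 \<noteq> 0"
      using assms(3) by (simp add: vec_eq_iff forall_2)
    moreover have "UNIV = {2, 1 :: 2}"
      by (simp only: UNIV_2 insert_commute)
    ultimately show ?thesis
      using that[of 2 1] by simp
  next
    case False
    then show ?thesis
      using that[of 1 2] by (simp add: UNIV_2)
  qed
  define l where "l = mp_var i - mp_const (x $ i / x $ j) * mp_var j"
  have "l dvd u $ k" for k
    unfolding l_def using assms(1) zero ij by (intro linear_form_dvd) auto
  then have "l dvd 1"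
    using assms(2) by blast
  then obtain q where "1 = l * q"
    by (elim dvdE)
  then have "1 = mp_eval l x * mp_eval q x"
    using mp_eval_mult[of l q x] by (metis mp_eval_one)
  moreover have "mp_eval l x = 0"
    using ij(3) by (simp add: l_def mp_eval_minus mp_eval_mult mp_eval_const mp_eval_var)
  ultimately show False
    by simp
qed

section \<open>Values and zeros over an algebraically closed field\<close>

lemma alg_closed_field_infinite: "infinite (UNIV :: 'a::alg_closed_field set)"
proof
  assume fin: "finite (UNIV :: 'a set)"
  \<comment> \<open>Over a finite field the product vanishes everywhere, so adding 1 leaves a
    polynomial of positive degree without roots.\<close>
  define p :: "'a poly" where "p = (\<Prod>a\<in>UNIV. [:- a, 1:]) + 1"
  have "degree (\<Prod>a\<in>UNIV. [:- a, 1 :: 'a:]) = card (UNIV :: 'a set)"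
    by (subst degree_prod_eq_sum_degree) auto
  moreover have "card (UNIV :: 'a set) > 0"
    using fin by (simp add: card_gt_0_iff)
  ultimately have "degree p > 0"
    unfolding p_def by (subst degree_add_eq_left) auto
  then obtain a where "poly p a = 0"
    using alg_closed_imp_poly_has_root by blast
  moreover have "poly p a = 1"
    using fin by (auto simp: p_def poly_prod)
  ultimately show False
    by simp
qed

lemma poly_nonzero_value:
  fixes p :: "'a::alg_closed_field poly"
  assumes "p \<noteq> 0"
  obtains t where "poly p t \<noteq> 0"
proof -
  have "\<exists>t. poly p t \<noteq> 0"
    using poly_roots_finite[OF assms] alg_closed_field_infinite[where 'a = 'a] 
    by (metis (mono_tags, lifting) Collect_cong UNIV_def)
  then show ?thesis
    using that by blast
qed

text \<open>Setting the second variable to 1 merges no terms: in a fixed degree the first exponent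
  determines the monomial. So the dehomogenised polynomial \<open>q\<close> is nonzero.\<close>

lemma form_nonzero_value:
  fixes h :: "('a::alg_closed_field, 2) mpoly"
  assumes "homogeneous e h" "h \<noteq> 0"
  obtains x where "x \<noteq> 0" "mp_eval h x \<noteq> 0"
proof -
  obtain m where m: "m \<in> Poly_Mapping.keys h"
    using assms(2) by (metis all_not_in_conv keys_eq_empty)
  define q where "q =
    (\<Sum>k\<in>Poly_Mapping.keys h. monom (Poly_Mapping.lookup h k) (Poly_Mapping.lookup k 1))"
  have eq: "k = m"
    if "k \<in> Poly_Mapping.keys h" "Poly_Mapping.lookup k 1 = Poly_Mapping.lookup m 1" for k
  proof (rule poly_mapping_eqI)
    have "mdeg k = mdeg m"
      using that(1) m assms(1) by (simp add: homogeneous_def)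
    then have "Poly_Mapping.lookup k 2 = Poly_Mapping.lookup m 2"
      using that(2) by (simp add: mdeg_def sum_2)
    then show "Poly_Mapping.lookup k i = Poly_Mapping.lookup m i" for i
      using that(2) exhaust_2[of i] by auto
  qed
  have "coeff q (Poly_Mapping.lookup m 1) =
      (\<Sum>k\<in>Poly_Mapping.keys h. if k = m then Poly_Mapping.lookup h k else 0)"
    unfolding q_def coeff_sum by (intro sum.cong) (auto dest: eq)
  also have "\<dots> \<noteq> 0"
    using m by (simp add: in_keys_iff)
  finally have "q \<noteq> 0"
    by auto
  then obtain t where t: "poly q t \<noteq> 0"
    by (rule poly_nonzero_value)
  define x :: "'a ^ 2" where "x = vector [t, 1]"
  have "poly q t = mp_eval h x"
    unfolding q_def mp_eval_def mp_extend_def x_def poly_sum poly_monom UNIV_prod_2 by simp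
  moreover have "x \<noteq> 0"
    by (simp add: x_def vec_eq_iff forall_2)
  ultimately show ?thesis
    using that t by simp
qed

text \<open>If \<open>h\<close> has no zero, then \<open>h(1, s)\<close> and \<open>h(s, 1)\<close> are constant in \<open>s\<close>, and
  \<open>h(s, 1) = s\<^sup>e h(1, 1 / s)\<close> gives \<open>s\<^sup>e = 1\<close> for all \<open>s \<noteq> 0\<close>.\<close>

lemma form_has_zero:
  fixes h :: "('a::alg_closed_field, 2) mpoly"
  assumes "homogeneous e h" "e \<ge> 1"
  obtains x where "x \<noteq> 0" "mp_eval h x = 0"
proof -
  have const: "mp_eval h (x + s *s y) = mp_eval h x"
    if "\<And>t. mp_eval h (x + t *s y) \<noteq> 0" for x y s
  proof -
    obtain q where q: "\<And>t. poly q t = mp_eval h (x + t *s y)"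
      using mp_eval_line[of h x y] by blast
    have "degree q = 0"
      using alg_closed_imp_poly_has_root[of q] that q by auto
    then obtain c where "q = [:c:]"
      by (rule degree_eq_zeroE)
    then show ?thesis
      using q[of s] q[of 0] by simp
  qed
  have "\<exists>x. x \<noteq> 0 \<and> mp_eval h x = 0"
  proof (rule ccontr)
    assume "\<not> ?thesis"
    then have nz: "x \<noteq> 0 \<Longrightarrow> mp_eval h x \<noteq> 0" for x
      by blast
    have shift: "vector [1, 0] + t *s vector [0, 1] = (vector [1, t] :: 'a ^ 2)"
      "vector [0, 1] + t *s vector [1, 0] = (vector [t, 1] :: 'a ^ 2)"
      "vector [1, t] \<noteq> (0 :: 'a ^ 2)" "vector [t, 1] \<noteq> (0 :: 'a ^ 2)" for t
      by (simp_all add: vec_eq_iff forall_2)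
    have 1: "mp_eval h (vector [1, t]) = mp_eval h (vector [1, 0])" for t
      using const[of "vector [1, 0]" "vector [0, 1]" t] nz by (simp add: shift)
    have 2: "mp_eval h (vector [t, 1]) = mp_eval h (vector [0, 1])" for t
      using const[of "vector [0, 1]" "vector [1, 0]" t] nz by (simp add: shift)
    have "s ^ e = 1" if "s \<noteq> 0" for s :: 'a
    proof -
      have "vector [s, 1] = s *s (vector [1, 1 / s] :: 'a ^ 2)"
        using that by (simp add: vec_eq_iff forall_2)
      then have "mp_eval h (vector [s, 1]) = s ^ e * mp_eval h (vector [1, 1 / s])"
        by (simp only: mp_eval_scale[OF assms(1)])
      \<comment> \<open>Both values equal the value of \<open>h\<close> at (1, 1), which lies on
        both lines.\<close>
      moreover have "mp_eval h (vector [s, 1]) = mp_eval h (vector [1, 1 / s])"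
        using 1[of 1] 1[of "1 / s"] 2[of 1] 2[of s] by simp
      moreover have "mp_eval h (vector [s, 1]) \<noteq> 0"
        using nz shift by blast
      ultimately show ?thesis
        by simp
    qed
    \<comment> \<open>The extra factor \<open>[:0, 1:]\<close> makes the identity hold at 0 as well,
      so the product vanishes at every point.\<close>
    then have "poly ([:0, 1:] * (monom 1 e - 1)) s = 0" for s :: 'a
      by (cases "s = 0") (simp_all add: poly_monom)
    then have "[:0, 1:] * (monom 1 e - 1) = (0 :: 'a poly)"
      using poly_nonzero_value by metis
    then have "monom 1 e = (1 :: 'a poly)"
      by simp
    then show False
      using assms(2) by (metis degree_1 degree_monom_eq not_one_le_zero zero_neq_one)
  qed
  then show ?thesis
    using that by blast
qed


section \<open>Irreducible and closed sets\<close>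

lemma mp_eval_rep_form_map:
  assumes "homogeneous e p" "P \<in> form_dom F"
  shows "mp_eval p (rep_proj (form_map F P)) = 0 \<longleftrightarrow> mp_eval (mp_subst F p) (rep_proj P) = 0"
  using assms
  by (simp add: form_map_def form_dom_def mp_eval_subst mp_eval_rep_eq_0_iff)

text \<open>A point outside \<open>A\<close> and a point outside \<open>B\<close> are joined by a
  line. The forms witnessing this restrict to nonzero polynomials on it, and some parameter avoids
  the roots of both.\<close>

lemma irreducible_proj:
  "irreducible_space (zariski :: ('a::alg_closed_field, 'n::finite) proj topology)"
  unfolding irreducible_space_def topspace_zariski
proof (intro conjI allI impI)
  fix A B :: "('a, 'n) proj set"
  assume AB: "closedin zariski A \<and> closedin zariski B \<and> A \<union> B = UNIV"
  show "A = UNIV \<or> B = UNIV"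
  proof (rule ccontr)
    assume "\<not> ?thesis"
    then obtain P Q where PQ: "P \<notin> A" "Q \<notin> B"
      by blast
    obtain S where S: "\<forall>f\<in>S. \<exists>d. homogeneous d f" "A = zero_locus S"
      using AB unfolding closedin_zariski zariski_closed_def by blast
    obtain T where T: "\<forall>f\<in>T. \<exists>d. homogeneous d f" "B = zero_locus T"
      using AB unfolding closedin_zariski zariski_closed_def by blast
    obtain f where f: "f \<in> S" "mp_eval f (rep_proj P) \<noteq> 0"
      using PQ(1) S(2) by (auto simp: zero_locus_def)
    obtain g where g: "g \<in> T" "mp_eval g (rep_proj Q) \<noteq> 0"
      using PQ(2) T(2) by (auto simp: zero_locus_def)
    define x where "x = rep_proj P"
    define y where "y = rep_proj Q - x"
    \<comment> \<open>The line of vectors may pass through 0; keeping coordinate \<open>i\<close>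
      nonzero ensures that \<open>z\<close> represents a point.\<close>
    obtain i where i: "x $ i \<noteq> 0"
      using rep_proj_nonzero[of P] by (auto simp: x_def vec_eq_iff)
    obtain p where p: "\<And>t. poly p t = mp_eval f (x + t *s y)"
      using mp_eval_line[of f x y] by blast
    obtain q where q: "\<And>t. poly q t = mp_eval g (x + t *s y)"
      using mp_eval_line[of g x y] by blast
    have "poly p 0 \<noteq> 0" "poly q 1 \<noteq> 0"
      using f(2) g(2) by (simp_all add: p q) (simp_all add: x_def y_def)
    then have "p \<noteq> 0" "q \<noteq> 0" "[:x $ i, y $ i:] \<noteq> 0"
      using i by auto
    then have "p * q * [:x $ i, y $ i:] \<noteq> 0"
      by (simp only: mult_eq_0_iff simp_thms)
    then obtain t where t: "poly (p * q * [:x $ i, y $ i:]) t \<noteq> 0"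
      by (rule poly_nonzero_value)
    define z where "z = x + t *s y"
    have "poly p t \<noteq> 0" "poly q t \<noteq> 0" "poly [:x $ i, y $ i:] t \<noteq> 0"
      using t unfolding poly_mult mult_eq_0_iff by blast+
    then have z: "mp_eval f z \<noteq> 0" "mp_eval g z \<noteq> 0" "z $ i \<noteq> 0"
      by (simp_all add: p q z_def)
    then have "z \<noteq> 0"
      by auto
    then have "abs_proj z \<notin> A" "abs_proj z \<notin> B"
      using z(1,2) f(1) g(1) S T mp_eval_rep_eq_0_iff unfolding zero_locus_def by blast+
    then show False
      using AB by blast
  qed
qed simp

text \<open>A closed cover of the image pulls back to a closed cover of the source, one member of
  which is everything.\<close>

lemma irreducible_space_image:
  assumes "irreducible_space T" "continuous_map T S f"
  shows "irreducible_space (subtopology S (f ` topspace T))"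
  unfolding irreducible_space_def
proof (intro conjI allI impI)
  have sub: "f ` topspace T \<subseteq> topspace S"
    using assms(2) by (rule continuous_map_image_subset_topspace)
  then have top: "topspace (subtopology S (f ` topspace T)) = f ` topspace T"
    by (simp add: topspace_subtopology Int_absorb1)
  then show "topspace (subtopology S (f ` topspace T)) \<noteq> {}"
    using assms(1) by (simp add: irreducible_space_def)
  fix A B
  assume AB: "closedin (subtopology S (f ` topspace T)) A \<and>
    closedin (subtopology S (f ` topspace T)) B \<and> A \<union> B = topspace (subtopology S (f ` topspace T))"
  have cont: "continuous_map T (subtopology S (f ` topspace T)) f"
    using assms(2) by (simp add: continuous_map_in_subtopology)
  have "closedin T {x \<in> topspace T. f x \<in> A}" "closedin T {x \<in> topspace T. f x \<in> B}"
    using AB cont by (auto intro: closedin_continuous_map_preimage)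
  moreover have "{x \<in> topspace T. f x \<in> A} \<union> {x \<in> topspace T. f x \<in> B} = topspace T"
    using AB top by blast
  ultimately have "{x \<in> topspace T. f x \<in> A} = topspace T \<or> {x \<in> topspace T. f x \<in> B} = topspace T"
    using assms(1) unfolding irreducible_space_def by blast
  moreover have "A \<union> B = f ` topspace T"
    using AB top by simp
  ultimately show "A = topspace (subtopology S (f ` topspace T)) \<or>
      B = topspace (subtopology S (f ` topspace T))"
    unfolding top by blast
qed

section \<open>Continuity and regularity of maps given by forms\<close>

lemma continuous_map_form_map:
  fixes F :: "('a::field, 'n::finite) mpoly ^ 'm::finite"
  assumes "\<forall>i. homogeneous d (F $ i)" "form_dom F = UNIV"
  shows "continuous_map zariski zariski (form_map F)"
  unfolding continuous_map_closedin topspace_zariski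
proof (intro conjI allI impI)
  fix A :: "('a, 'm) proj set"
  assume "closedin zariski A"
  then obtain S where S: "\<forall>f\<in>S. \<exists>e. homogeneous e f" "A = zero_locus S"
    unfolding closedin_zariski zariski_closed_def by blast
  have "\<forall>f\<in>mp_subst F ` S. \<exists>e. homogeneous e f"
    using S(1) assms(1) homogeneous_subst by blast
  moreover have "{P \<in> UNIV. form_map F P \<in> A} = zero_locus (mp_subst F ` S)"
    using S assms(2) mp_eval_rep_form_map[of _ _ _ F] unfolding zero_locus_def by blast
  ultimately show "closedin zariski {P \<in> UNIV. form_map F P \<in> A}"
    unfolding closedin_zariski zariski_closed_def by blast
qed simp

lemma openin_form_dom:
  fixes F :: "('a::field, 'n::finite) mpoly ^ 'm"
  assumes "\<forall>i. homogeneous d (F $ i)"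
  shows "openin zariski (form_dom F)"
proof -
  have "- form_dom F = zero_locus (range (($) F))"
    by (auto simp: form_dom_def zero_locus_def mp_eval_vec_def vec_eq_iff)
  then show ?thesis
    unfolding openin_zariski zariski_closed_def using assms by blast
qed

lemma regular_on_form_map:
  assumes "\<forall>i. homogeneous d (F $ i)" "X \<subseteq> form_dom F" "\<And>P. P \<in> X \<Longrightarrow> f P = form_map F P"
  shows "regular_on X f"
  unfolding regular_on_def
proof
  fix P assume "P \<in> X"
  moreover have "openin (subtopology zariski X) X"
    using openin_topspace[of "subtopology zariski X"] by (simp add: topspace_zariski)
  ultimately show "\<exists>U F d. openin (subtopology zariski X) U \<and> P \<in> U \<and>
      (\<forall>i. homogeneous d (F $ i)) \<and> U \<subseteq> form_dom F \<and> (\<forall>Q\<in>U. f Q = form_map F Q)"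
    using assms by blast
qed

text \<open>The tuple of variables represents the identity. This settles regularity of both
  composites of the parametrisation and its inverse, with no general result on composing regular
  maps.\<close>

lemma regular_on_ident:
  fixes X :: "('a::field, 'n::finite) proj set"
  assumes "\<And>P. P \<in> X \<Longrightarrow> f P = P"
  shows "regular_on X f"
proof (rule regular_on_form_map)
  define V :: "('a, 'n) mpoly ^ 'n" where "V = (\<chi> i. mp_var i)"
  have eval: "mp_eval_vec V x = x" for x
    by (simp add: V_def mp_eval_vec_def mp_eval_var vec_eq_iff)
  show "\<forall>i. homogeneous 1 (V $ i)"
    by (simp add: V_def homogeneous_var del: One_nat_def)
  show "X \<subseteq> form_dom V"
    by (simp add: form_dom_def eval rep_proj_nonzero)
  show "f P = form_map V P" if "P \<in> X" for P
    using assms[OF that] by (simp add: form_map_def eval abs_rep_proj)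
qed


section \<open>The parametrisation and its inverse\<close>

lemma mp_extend_single:
  assumes "h 0 = 0"
  shows "mp_extend h x (Poly_Mapping.single m c) = h c * (\<Prod>i\<in>UNIV. x i ^ Poly_Mapping.lookup m i)"
  using assms by (auto simp: mp_extend_def)

lemma mp_extend_add:
  assumes "h 0 = 0" "\<And>a b. h (a + b) = h a + h b"
  shows "mp_extend h x (p + q) = mp_extend h x p + mp_extend h x q"
proof -
  let ?A = "Poly_Mapping.keys p \<union> Poly_Mapping.keys q"
  have super: "mp_extend h x r =
      (\<Sum>m\<in>?A. h (Poly_Mapping.lookup r m) * (\<Prod>i\<in>UNIV. x i ^ Poly_Mapping.lookup m i))"
    if "Poly_Mapping.keys r \<subseteq> ?A" for r
    unfolding mp_extend_def using that assms(1)
    by (intro sum.mono_neutral_left) (auto simp: in_keys_iff)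
  show ?thesis
    by (simp add: super Poly_Mapping.keys_add lookup_add assms(2) distrib_right sum.distrib)
qed

text \<open>The image of the linear polynomial is \<open>(a * u $ i - b * u $ j) Z\<close>; its
  coefficient must vanish.\<close>

lemma param_kernel_linear:
  assumes "mp_const a * mp_var i - mp_const b * mp_var j \<in> param_kernel u"
  shows "a * u $ i = b * u $ j"
proof -
  have "mp_const a * mp_var i - mp_const b * mp_var j =
      Poly_Mapping.single (Poly_Mapping.single i 1) a +
      Poly_Mapping.single (Poly_Mapping.single j 1) (- b)"
    by (simp add: mp_const_def mp_var_def mult_single single_uminus)
  then have "[:0, a * u $ i - b * u $ j:] = 0"
    using assms
    by (simp add: param_kernel_def param_hom_def mp_extend_add mp_extend_single prod_power_single
        mult.commute)
  then show ?thesis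
    by simp
qed

text \<open>Given \<open>t\<^sub>1 u\<^sub>2 = t\<^sub>2 u\<^sub>1\<close>, the form \<open>u\<^sub>1\<close> vanishes at \<open>(0, 1)\<close> and hence is divisible by \<open>t\<^sub>1\<close>.\<close>

lemma common_cofactor:
  fixes p q :: "('a::field, 2) mpoly"
  assumes "homogeneous d p" "d \<ge> 1" "mp_var 1 * q = mp_var 2 * p"
  obtains h where "homogeneous (d - 1) h" "p = mp_var 1 * h" "q = mp_var 2 * h"
proof -
  define x :: "'a ^ 2" where "x = vector [0, 1]"
  have "mp_eval (mp_var 1 * q) x = mp_eval (mp_var 2 * p) x"
    by (simp add: assms(3))
  then have "mp_eval p x = 0"
    by (simp add: mp_eval_mult mp_eval_var x_def)
  \<comment> \<open>At (0, 1) the quotient of coordinates is 0, so the linear form is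
    \<open>mp_var 1\<close> itself.\<close>
  then have "mp_var 1 - mp_const (x $ 1 / x $ 2) * mp_var 2 dvd p"
    using assms(1) by (intro linear_form_dvd) (auto simp: x_def UNIV_2)
  then have "mp_var 1 dvd p"
    by (simp add: x_def mp_const_def)
  then obtain h where h: "p = mp_var 1 * h"
    by (elim dvdE)
  have "mp_var 1 * q = mp_var 1 * (mp_var 2 * h)"
    using assms(3) by (simp add: h mult.left_commute)
  moreover have "mp_var 1 \<noteq> (0 :: ('a, 2) mpoly)"
    by (metis lookup_single_eq lookup_zero mp_var_def zero_neq_one)
  ultimately have "q = mp_var 2 * h"
    by simp
  moreover have "homogeneous (d - 1) h"
    using assms(1,2) homogeneous_var_mult_cancel unfolding h by blast
  ultimately show ?thesis
    using that h by blast
qed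

text \<open>Where \<open>(X\<^sub>1, X\<^sub>2) \<noteq> 0\<close>, the equation \<open>X\<^sub>3 h(X\<^sub>1, X\<^sub>2) = u\<^sub>3(X\<^sub>1, X\<^sub>2)\<close> says
  \<open>X\<^sub>3 = u\<^sub>3 / h\<close>; the point \<open>(0 : 0 : 1)\<close> satisfies it iff \<open>h\<close> is not constant, that is, iff
  \<open>h\<close> has a zero.\<close>

lemma closedin_range_param:
  fixes u :: "('a::alg_closed_field, 2) mpoly ^ 3"
  assumes u: "\<forall>i. homogeneous d (u $ i)" and d: "d \<ge> 1"
    and nz: "\<And>x. x \<noteq> 0 \<Longrightarrow> mp_eval_vec u x \<noteq> 0"
    and h: "homogeneous (d - 1) h" "u $ 1 = mp_var 1 * h" "u $ 2 = mp_var 2 * h" "h \<noteq> 0"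
  shows "closedin zariski (range (form_map u))"
proof -
  define V :: "('a, 3) mpoly ^ 2" where "V = vector [mp_var 1, mp_var 2]"
  define f where "f = mp_var 3 * mp_subst V h - mp_subst V (u $ 3)"
  have V: "\<forall>i. homogeneous 1 (V $ i)"
    by (simp add: V_def forall_2 homogeneous_var del: One_nat_def)
  have "homogeneous (1 + (d - 1) * 1) (mp_var 3 * mp_subst V h)"
    using h(1) V by (intro homogeneous_mult homogeneous_subst homogeneous_var)
  moreover have "homogeneous (d * 1) (mp_subst V (u $ 3))"
    using u V by (intro homogeneous_subst) auto
  ultimately have hom: "homogeneous d f"
    using d by (simp add: f_def homogeneous_minus)
  have Veval: "mp_eval_vec V x = vector [x $ 1, x $ 2]" for x
    by (simp add: V_def mp_eval_vec_def vec_eq_iff forall_2 mp_eval_var)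
  have f: "mp_eval f x = x $ 3 * mp_eval h (vector [x $ 1, x $ 2])
      - mp_eval (u $ 3) (vector [x $ 1, x $ 2])" for x
    by (simp add: f_def mp_eval_minus mp_eval_mult mp_eval_var mp_eval_subst Veval)
  have ueval: "mp_eval_vec u t =
      vector [t $ 1 * mp_eval h t, t $ 2 * mp_eval h t, mp_eval (u $ 3) t]"
    for t
    by (simp add: mp_eval_vec_def vec_eq_iff forall_3 h mp_eval_mult mp_eval_var)
  \<comment> \<open>Membership in the range only needs proportionality to a value of
    \<open>u\<close>: the factor \<open>c\<close> is nonzero because \<open>u\<close> has no
    zero.\<close>
  have image: "abs_proj x \<in> range (form_map u)"
    if "t \<noteq> 0" "x \<noteq> 0" "mp_eval_vec u t = c *s x" for t x c
  proof -
    have "c \<noteq> 0"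
      using nz[OF that(1)] that(3) by auto
    then have "abs_proj x = abs_proj (mp_eval_vec u t)"
      using that nz by (subst abs_proj_eq_iff) auto
    also have "\<dots> = form_map u (abs_proj t)"
      using form_map_abs_proj[OF u that(1) nz[OF that(1)]] by simp
    finally show ?thesis
      by blast
  qed
  have "P \<in> range (form_map u) \<longleftrightarrow> mp_eval f (rep_proj P) = 0" for P
  proof
    assume "P \<in> range (form_map u)"
    then obtain t where t: "t \<noteq> 0" "P = abs_proj (mp_eval_vec u t)"
      using rep_proj_nonzero by (auto simp: form_map_def)
    define s where "s = mp_eval h t"
    have "vector [t $ 1 * s, t $ 2 * s] = s *s t"
      by (simp add: vec_eq_iff forall_2)
    \<comment> \<open>The first two coordinates of the image are \<open>s *s t\<close>; the degrees
      \<open>d - 1\<close> of \<open>h\<close> and \<open>d\<close> of \<open>u $ 3\<close> produce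
      the two powers of \<open>s\<close>.\<close>
    then have "mp_eval f (mp_eval_vec u t) =
        mp_eval (u $ 3) t * (s ^ (d - 1) * s) - s ^ d * mp_eval (u $ 3) t"
      using h(1) u by (simp add: f ueval s_def[symmetric] mp_eval_scale)
    also have "s ^ (d - 1) * s = s ^ d"
      using d by (metis power_minus_mult less_eq_Suc_le One_nat_def)
    finally show "mp_eval f (rep_proj P) = 0"
      using hom nz t by (simp add: mp_eval_rep_eq_0_iff)
  next
    assume zero: "mp_eval f (rep_proj P) = 0"
    define x where "x = rep_proj P"
    define t :: "'a ^ 2" where "t = vector [x $ 1, x $ 2]"
    have x: "x \<noteq> 0" "abs_proj x = P"
      by (simp_all add: x_def rep_proj_nonzero abs_rep_proj)
    have eq: "x $ 3 * mp_eval h t = mp_eval (u $ 3) t"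
      using zero by (simp add: f t_def x_def)
    show "P \<in> range (form_map u)"
    proof (cases "t = 0")
      case False
      \<comment> \<open>The first two coordinates of \<open>x\<close> serve as the parameter; the
        third component matches by the equation of the curve.\<close>
      have "mp_eval_vec u t = mp_eval h t *s x"
        using eq by (simp add: ueval vec_eq_iff forall_3) (simp add: t_def mult.commute)
      then show ?thesis
        using image[OF False x(1)] x(2) by blast
    next
      case True
      then have x12: "x $ 1 = 0" "x $ 2 = 0"
        by (simp_all add: t_def vec_eq_iff forall_2)
      then have x3: "x $ 3 \<noteq> 0"
        using x(1) by (simp add: vec_eq_iff forall_3)
      \<comment> \<open>Since \<open>d \<ge> 1\<close>, \<open>u $ 3\<close> vanishes at 0, so the
        equation makes \<open>h\<close> vanish there. This excludes \<open>d = 1\<close>, where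
        \<open>h\<close> is a nonzero constant.\<close>
      have "mp_eval (u $ 3) 0 = 0"
        using mp_eval_scale[of d "u $ 3" 0 0] u d by (simp add: power_0_left)
      then have h0: "mp_eval h 0 = 0"
        using eq x3 True by simp
      have "d - 1 \<noteq> 0"
      proof
        assume "d - 1 = 0"
        then have "mp_eval h y = 0" for y
          using h0 mp_eval_scale[OF h(1), of 0 y] by simp
        then show False
          using form_nonzero_value[OF h(1,4)] by metis
      qed
      \<comment> \<open>At a zero of \<open>h\<close> the first two components of \<open>u\<close>
        vanish, so its image is the point (0 : 0 : 1) under consideration.\<close>
      then obtain s where s: "s \<noteq> 0" "mp_eval h s = 0"
        using form_has_zero[OF h(1)] by (metis less_one not_less)
      then have "mp_eval_vec u s = (mp_eval (u $ 3) s / x $ 3) *s x"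
        using x3 by (simp add: ueval vec_eq_iff forall_3 x12)
      then show ?thesis
        using image[OF s(1) x(1)] x(2) by blast
    qed
  qed
  then have "range (form_map u) = zero_locus {f}"
    by (auto simp: zero_locus_def)
  then show ?thesis
    unfolding closedin_zariski zariski_closed_def using hom by blast
qed

theorem proposition2p1:
  fixes u :: "('a::alg_closed_field, 2) mpoly ^ 3"
    and d :: nat
    and \<phi> :: "('a, 2) proj \<Rightarrow> ('a, 3) proj"
    and C :: "('a, 3) proj set"
  assumes "d \<ge> 1"
    and "\<forall>i. u $ i \<noteq> 0 \<and> homogeneous d (u $ i)"
    and "\<forall>g. (\<forall>i. g dvd u $ i) \<longrightarrow> g dvd 1"
    and "\<phi> = form_map u"
    and "C = range \<phi>"
    and "mp_const (mp_var 1) * mp_var 2 - mp_const (mp_var 2) * mp_var 1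
      \<in> param_kernel_graded u 1 1"
  shows "birational_map UNIV C (UNIV, \<phi>) \<and>
    rational_inverse UNIV C (UNIV, \<phi>) (form_rational C (vector [mp_var 1, mp_var 2]))"
proof -
  have u: "\<forall>i. homogeneous d (u $ i)"
    using assms(2) by blast
  have "mp_var 1 * u $ 2 = mp_var 2 * u $ 1"
    using assms(6) by (intro param_kernel_linear) (simp add: param_kernel_graded_def)
  then obtain h where h: "homogeneous (d - 1) h" "u $ 1 = mp_var 1 * h" "u $ 2 = mp_var 2 * h"
    using common_cofactor assms(1) u by metis
  have "h \<noteq> 0"
    using assms(2) h(2) by fastforce
  have nz: "mp_eval_vec u x \<noteq> 0" if "x \<noteq> 0" for x
    using coprime_forms_no_common_zero[OF u assms(3) that] .
  then have dom: "form_dom u = UNIV"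
    by (auto simp: form_dom_def rep_proj_nonzero)
  define V :: "('a, 3) mpoly ^ 2" where "V = vector [mp_var 1, mp_var 2]"
  have V: "\<forall>i. homogeneous 1 (V $ i)"
    by (simp add: V_def forall_2 homogeneous_var del: One_nat_def)
  \<comment> \<open>The key identity: projecting \<open>u\<close> to its first two components gives
    \<open>t\<close> scaled by \<open>h(t)\<close>, hence the same point wherever \<open>h\<close>
    is nonzero.\<close>
  have VUeval: "mp_eval_vec V (mp_eval_vec u x) = mp_eval h x *s x" for x
    by (simp add: V_def mp_eval_vec_def vec_eq_iff forall_2 mp_eval_var h mp_eval_mult)
  have phi: "\<phi> (abs_proj x) = abs_proj (mp_eval_vec u x)" if "x \<noteq> 0" for x
    unfolding assms(4) using form_map_abs_proj[OF u that nz[OF that]] .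
  have dom_iff: "\<phi> (abs_proj x) \<in> form_dom V \<longleftrightarrow> mp_eval h x \<noteq> 0" if "x \<noteq> 0" for x
    using that nz by (simp add: phi abs_proj_in_form_dom_iff[OF V] VUeval)
  have inverse: "form_map V (\<phi> P) = P" if "\<phi> P \<in> form_dom V" for P
  proof -
    define x where "x = rep_proj P"
    have x: "x \<noteq> 0" "P = abs_proj x"
      by (simp_all add: x_def rep_proj_nonzero abs_rep_proj)
    then have hx: "mp_eval h x \<noteq> 0"
      using that dom_iff by simp
    then have "form_map V (\<phi> P) = abs_proj (mp_eval h x *s x)"
      using x nz by (simp add: phi form_map_abs_proj[OF V] VUeval)
    also have "\<dots> = abs_proj x"
      using x(1) hx by (subst eq_commute, subst abs_proj_eq_iff) auto
    finally show ?thesis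
      using x(2) by simp
  qed
  have cont: "continuous_map zariski zariski \<phi>"
    unfolding assms(4) using u dom by (rule continuous_map_form_map)
  have line: "projective_variety (UNIV :: ('a, 2) proj set)"
    using irreducible_proj closedin_topspace[of "zariski :: ('a, 2) proj topology"]
    by (simp add: projective_variety_def topspace_zariski)
  have "closedin zariski C"
    unfolding assms(4,5) using u assms(1) nz h \<open>h \<noteq> 0\<close> by (rule closedin_range_param)
  then have curve: "projective_variety C"
    using irreducible_space_image[OF irreducible_proj cont]
    by (simp add: projective_variety_def topspace_zariski assms(5))
  have opn: "openin (subtopology zariski C) (C \<inter> form_dom V)"
    using openin_form_dom[OF V] by (auto simp: openin_subtopology)
  have opn': "openin zariski {P. \<phi> P \<in> form_dom V}"
    using openin_continuous_map_preimage[OF cont openin_form_dom[OF V]]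
    by (simp add: topspace_zariski)
  \<comment> \<open>A point where \<open>h\<close> does not vanish makes the domains of both
    composites nonempty.\<close>
  obtain x where "x \<noteq> 0" "mp_eval h x \<noteq> 0"
    using form_nonzero_value[OF h(1) \<open>h \<noteq> 0\<close>] .
  then have "\<phi> (abs_proj x) \<in> form_dom V"
    using dom_iff by blast
  then have ne: "{P. \<phi> P \<in> form_dom V} \<noteq> {}" "C \<inter> form_dom V \<noteq> {}"
    using assms(5) by blast+
  have "regular_on UNIV \<phi>"
    using u dom by (intro regular_on_form_map[where F = u]) (simp_all add: assms(4))
  then have r: "rational_map UNIV C (UNIV, \<phi>)"
    using line curve openin_topspace[of "zariski :: ('a, 2) proj topology"]
    by (simp add: rational_map_def topspace_zariski assms(5))
  have "regular_on (C \<inter> form_dom V) (form_map V)"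
    using V by (intro regular_on_form_map[where F = V]) simp_all
  then have s: "rational_map C UNIV (form_rational C V)"
    using line curve opn ne(2) by (simp add: rational_map_def form_rational_def)
  have sr: "rational_comp (form_rational C V) (UNIV, \<phi>) =
      ({P. \<phi> P \<in> form_dom V}, form_map V \<circ> \<phi>)"
    by (simp add: rational_comp_def form_rational_def assms(5))
  have "regular_on {P. \<phi> P \<in> form_dom V} (form_map V \<circ> \<phi>)"
    by (rule regular_on_ident) (simp add: inverse)
  then have sr': "rational_map UNIV UNIV (rational_comp (form_rational C V) (UNIV, \<phi>))"
      "rational_eq (rational_comp (form_rational C V) (UNIV, \<phi>)) (rational_id UNIV)"
    using line opn' ne(1)
    by (simp_all add: sr rational_map_def rational_eq_def rational_id_def inverse)
  have rs: "rational_comp (UNIV, \<phi>) (form_rational C V) =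
      (C \<inter> form_dom V, \<phi> \<circ> form_map V)"
    by (simp add: rational_comp_def form_rational_def Int_def)
  \<comment> \<open>Each such \<open>Q\<close> is \<open>\<phi> P\<close> for some \<open>P\<close>,
    and \<open>inverse\<close> recovers that \<open>P\<close>.\<close>
  have inverse': "\<phi> (form_map V Q) = Q" if "Q \<in> C \<inter> form_dom V" for Q
    using that inverse by (auto simp: assms(5))
  then have "regular_on (C \<inter> form_dom V) (\<phi> \<circ> form_map V)"
    by (intro regular_on_ident) simp
  then have rs': "rational_map C C (rational_comp (UNIV, \<phi>) (form_rational C V))"
      "rational_eq (rational_comp (UNIV, \<phi>) (form_rational C V)) (rational_id C)"
    using curve opn ne(2) inverse'
    by (auto simp add: rs rational_map_def rational_eq_def rational_id_def)
  have "rational_inverse UNIV C (UNIV, \<phi>) (form_rational C V)"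
    unfolding rational_inverse_def using r s sr' rs' by blast
  then show ?thesis
    unfolding birational_map_def V_def by blast
qed

end
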